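(* Let $X \subseteq \mathcal A^{\mathbb Z}$ be a transitive subshift. Then there is a short exact sequence of $\mathbb R$-vector spaces $$0 \longrightarrow \mathcal F^0_X \overset{\iota}{\longrightarrow} \mathcal F_X \overset{\eta}{\longrightarrow} \mathcal C_X \longrightarrow 0$$ where $\iota$ is the inclusion map and $\eta$ maps $\rho$ to $c_\rho$. In particular, as an $\mathbb R$-vector space, $\mathcal C_X$ has dimension $r-1$, where $r$ is the number of connected components of $\Gamma_X(\varepsilon)$.
   Context: A subshift is a closed set $X\subseteq\mathcal A^{\mathbb Z}$ ($\mathcal A$ a finite alphabet) with $S(X)=X$, $S$ the shift map; it is transitive if some point $x\in X$ has dense orbit $\{S^nx:n\in\mathbb Z\}$ in $X$. $\mathcal L(X)$ is the set of finite words occurring in points of $X$; every letter of $\mathcal A$ is assumed to occur in $\mathcal L(X)$. The extension graph $\Gamma_X(\varepsilon)$ of the empty word is the bipartite undirected graph whose vertices are two disjoint copies $\mathcal A_L=\{a_L:a\in\mathcal A\}$ and $\mathcal A_R=\{a_R:a\in\mathcal A\}$ of $\mathcal A$, with an edge between $a_L$ and $b_R$ if and only if $ab\in\mathcal L(X)$. A return word to a letter $a$ in $X$ is a word $w\in\mathcal A^*$ such that $wa\in\mathcal L(X)$ and $wa$ contains exactly two occurrences of $a$, one as a prefix and one as a suffix. A letter-coboundary in $X$ is a monoid morphism $c:\mathcal A^*\to(\mathbb R,+)$ with $c(w)=0$ for every letter $a$ and every return word $w$ to $a$ in $X$. $\mathcal C_X$ is the real vector space of letter-coboundaries in $X$.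 $\mathcal F_X$ is the real vector space of maps $\rho:\mathcal A\to\mathbb R$ such that $\rho(a)=\rho(b)$ whenever $a_R$ and $b_R$ lie in the same connected component of $\Gamma_X(\varepsilon)$, and $\mathcal F_X^0\subseteq\mathcal F_X$ is the subspace of constant maps. For $\rho\in\mathcal F_X$, $c_\rho:\mathcal A^*\to\mathbb R$ is the monoid morphism given on letters by $c_\rho(a)=\rho(b)-\rho(a)$, where $b$ is any letter with $ab\in\mathcal L(X)$ (the value does not depend on the choice of $b$). *)

theory Defs
  imports "HOL-Analysis.Analysis" "HOL-Library.Function_Algebras" "HOL-Library.Sublist"
begin

section \<open>Subshifts\<close>

text \<open>The alphabet is a finite type. The full shift carries the product of the discrete
  topologies.\<close>

definition full_shift :: "(int \<Rightarrow> 'a) topology" where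
  "full_shift = product_topology (\<lambda>_. discrete_topology UNIV) UNIV"

text \<open>\<open>shift n\<close> is the \<open>n\<close>-th power of the shift map, for every integer \<open>n\<close>; the shift map itself
  is \<open>shift 1\<close>.\<close>

definition shift :: "int \<Rightarrow> (int \<Rightarrow> 'a) \<Rightarrow> (int \<Rightarrow> 'a)" where
  "shift n x = (\<lambda>i. x (i + n))"

lemma shift_0 [simp]: "shift 0 x = x"
  by (simp add: shift_def)

lemma shift_shift [simp]: "shift m (shift n x) = shift (m + n) x"
  by (simp add: shift_def algebra_simps)

definition subshift :: "(int \<Rightarrow> 'a) set \<Rightarrow> bool" where
  "subshift X \<longleftrightarrow> closedin full_shift X \<and> shift 1 ` X = X"

definition transitive_subshift :: "(int \<Rightarrow> 'a) set \<Rightarrow> bool" where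
  "transitive_subshift X \<longleftrightarrow>
     subshift X \<and> (\<exists>x\<in>X. X \<subseteq> full_shift closure_of (range (\<lambda>n. shift n x)))"

definition language :: "(int \<Rightarrow> 'a) set \<Rightarrow> 'a list set" where
  "language X = {map (\<lambda>k. x (i + int k)) [0..<n] | x i n. x \<in> X}"


section \<open>The extension graph of the empty word\<close>

text \<open>The left copy of a letter \<open>a\<close> is \<open>Inl a\<close>, the right copy is \<open>Inr a\<close>. The vertex set is the
  whole sum type, and edges are unordered pairs.\<close>

definition extension_edges :: "(int \<Rightarrow> 'a) set \<Rightarrow> ('a + 'a) set set" where
  "extension_edges X = {{Inl a, Inr b} | a b. [a, b] \<in> language X}"

definition extension_connected :: "(int \<Rightarrow> 'a) set \<Rightarrow> (('a + 'a) \<times> ('a + 'a)) set" where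
  "extension_connected X = {(u, v). {u, v} \<in> extension_edges X}\<^sup>*"

definition extension_components :: "(int \<Rightarrow> 'a) set \<Rightarrow> ('a + 'a) set set" where
  "extension_components X = UNIV // extension_connected X"

lemma equiv_extension_connected: "equiv UNIV (extension_connected X)"
proof (rule equivI)
  have "sym {(u, v). {u, v} \<in> extension_edges X}"
    by (auto simp: sym_def insert_commute)
  then show "sym (extension_connected X)"
    unfolding extension_connected_def by (rule sym_rtrancl)
qed (auto simp: extension_connected_def refl_rtrancl trans_rtrancl)


section \<open>Return words and letter-coboundaries\<close>

definition return_word :: "(int \<Rightarrow> 'a) set \<Rightarrow> 'a \<Rightarrow> 'a list \<Rightarrow> bool" where
  "return_word X a w \<longleftrightarrow>
     w @ [a] \<in> language X \<and> count_list (w @ [a]) a = 2 \<and>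
     prefix [a] (w @ [a]) \<and> suffix [a] (w @ [a])"

definition word_morphism :: "('a list \<Rightarrow> real) \<Rightarrow> bool" where
  "word_morphism c \<longleftrightarrow> c [] = 0 \<and> (\<forall>u v. c (u @ v) = c u + c v)"

definition letter_coboundaries :: "(int \<Rightarrow> 'a) set \<Rightarrow> ('a list \<Rightarrow> real) set" where
  "letter_coboundaries X =
     {c. word_morphism c \<and> (\<forall>a w. return_word X a w \<longrightarrow> c w = 0)}"

definition component_maps :: "(int \<Rightarrow> 'a) set \<Rightarrow> ('a \<Rightarrow> real) set" where
  "component_maps X =
     {\<rho>. \<forall>a b. (Inr a, Inr b) \<in> extension_connected X \<longrightarrow> \<rho> a = \<rho> b}"

definition constant_maps :: "(int \<Rightarrow> 'a) set \<Rightarrow> ('a \<Rightarrow> real) set" where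
  "constant_maps X = {\<rho> \<in> component_maps X. \<exists>t. \<forall>a. \<rho> a = t}"

text \<open>The morphism \<open>c\<^sub>\<rho>\<close>, summed over the letters of a word. The choice of a successor is
  irrelevant for \<open>\<rho>\<close> in \<open>component_maps X\<close>, by \<open>coboundary_of_letter\<close> below.\<close>

definition coboundary_of :: "(int \<Rightarrow> 'a) set \<Rightarrow> ('a \<Rightarrow> real) \<Rightarrow> ('a list \<Rightarrow> real)" where
  "coboundary_of X \<rho> w = (\<Sum>a\<leftarrow>w. \<rho> (SOME b. [a, b] \<in> language X) - \<rho> a)"

lemma word_morphism_coboundary_of: "word_morphism (coboundary_of X \<rho>)"
  by (simp add: word_morphism_def coboundary_of_def)

lemma coboundary_of_letter:
  assumes "\<rho> \<in> component_maps X" and ab: "[a, b] \<in> language X"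
  shows "coboundary_of X \<rho> [a] = \<rho> b - \<rho> a"
proof -
  define b' where "b' = (SOME b. [a, b] \<in> language X)"
  have ab': "[a, b'] \<in> language X"
    unfolding b'_def using ab by (rule someI)
  let ?E = "{(u, v). {u, v} \<in> extension_edges X}"
  have "(Inr b', Inl a) \<in> ?E" "(Inl a, Inr b) \<in> ?E"
    using ab ab' by (auto simp: extension_edges_def insert_commute)
  then have "(Inr b', Inr b) \<in> extension_connected X"
    unfolding extension_connected_def by (meson converse_rtrancl_into_rtrancl r_into_rtrancl)
  then have "\<rho> b' = \<rho> b"
    using assms(1) by (auto simp: component_maps_def)
  then show ?thesis
    by (simp add: coboundary_of_def b'_def)
qed


section \<open>Short exact sequences of real vector spaces\<close>

text \<open>Real-valued functions on any type form a real vector space under pointwise operations; the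
  additive structure comes from \<^theory>\<open>HOL-Library.Function_Algebras\<close>.\<close>

instantiation "fun" :: (type, real_vector) real_vector
begin

definition scaleR_fun :: "real \<Rightarrow> ('a \<Rightarrow> 'b) \<Rightarrow> 'a \<Rightarrow> 'b" where
  "scaleR_fun r f = (\<lambda>x. r *\<^sub>R f x)"

instance
  by standard (auto simp: scaleR_fun_def fun_eq_iff algebra_simps)

end

text \<open>The spaces are subspaces of ambient vector spaces, and linearity is only required there.\<close>

definition linear_between ::
    "'u::real_vector set \<Rightarrow> 'v::real_vector set \<Rightarrow> ('u \<Rightarrow> 'v) \<Rightarrow> bool" where
  "linear_between U V f \<longleftrightarrow>
     subspace U \<and> subspace V \<and> f ` U \<subseteq> V \<and>
     (\<forall>x\<in>U. \<forall>y\<in>U. f (x + y) = f x + f y) \<and>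
     (\<forall>r. \<forall>x\<in>U. f (r *\<^sub>R x) = r *\<^sub>R f x)"

definition short_exact_sequence ::
    "'u::real_vector set \<Rightarrow> ('u \<Rightarrow> 'v::real_vector) \<Rightarrow> 'v set \<Rightarrow>
     ('v \<Rightarrow> 'w::real_vector) \<Rightarrow> 'w set \<Rightarrow> bool" where
  "short_exact_sequence U f V g W \<longleftrightarrow>
     linear_between U V f \<and> linear_between V W g \<and>
     inj_on f U \<and> f ` U = {x \<in> V. g x = 0} \<and> g ` V = W"

end

theory Submission
  imports Defs
begin

text \<open>
  Write \<open>x\<close> for a point with dense orbit. Every word of the language occurs in \<open>x\<close>, so both
  conditions defining the spaces in the sequence can be read along the single sequence \<open>x\<close>.

  The identity \<open>c\<^sub>\<rho>(a) = \<rho>(b) - \<rho>(a)\<close> for \<open>ab\<close> in the language telescopes: the value of \<open>c\<^sub>\<rho>\<close> on a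
  factor of a point is the difference of the values of \<open>\<rho>\<close> at its two ends. Hence \<open>c\<^sub>\<rho>\<close> vanishes on
  return words, and if \<open>c\<^sub>\<rho> = 0\<close> then \<open>\<rho>\<close> is constant along \<open>x\<close>, on which all letters occur. This
  gives well-definedness of \<open>\<eta>\<close> and its kernel (\<open>coboundary_of_factor\<close>,
  \<open>coboundary_of_in_letter_coboundaries\<close>, \<open>coboundary_of_eq_0_iff_constant\<close>).

  Conversely, integrate a letter-coboundary \<open>c\<close> along \<open>x\<close>: there is \<open>p\<close> on the integers with
  \<open>p (n + 1) - p n = c (x\<^sub>n)\<close>. Between two occurrences of a letter \<open>a\<close>, the sequence \<open>x\<close> is a
  concatenation of return words to \<open>a\<close>, so \<open>p n\<close> depends only on the letter \<open>x\<^sub>n\<close>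
  (\<open>letter_coboundary_between_occurrences\<close>). Thus \<open>p n = \<rho> (x\<^sub>n)\<close> for a map \<open>\<rho>\<close> on letters, and
  \<open>\<rho>(b) = \<rho>(a) + c(a)\<close> whenever \<open>ab\<close> is in the language. All right neighbours of a left vertex
  thus get the same value, which forces \<open>\<rho>\<close> to be constant on components, and \<open>c = c\<^sub>\<rho>\<close>
  (\<open>letter_coboundary_is_coboundary_of\<close>).

  For the dimension, fix a letter \<open>b\<^sub>0\<close>. Subtracting constants shows that \<open>\<eta>\<close> restricts to an
  isomorphism from the maps in \<open>\<F>\<^sub>X\<close> vanishing at \<open>b\<^sub>0\<close> onto \<open>\<C>\<^sub>X\<close>, and the former space has as a
  basis the indicators of the components not containing the right copy of \<open>b\<^sub>0\<close>. These indicators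
  are nonzero and distinct because every component contains a right vertex: every letter occurs,
  hence has a successor.
\<close>

section \<open>Factors of a point and density\<close>

definition factor :: "(int \<Rightarrow> 'a) \<Rightarrow> int \<Rightarrow> nat \<Rightarrow> 'a list" where
  "factor x i n = map (\<lambda>k. x (i + int k)) [0..<n]"

lemma factor_0 [simp]: "factor x i 0 = []"
  by (simp add: factor_def)

lemma length_factor [simp]: "length (factor x i n) = n"
  by (simp add: factor_def)

lemma factor_Suc: "factor x i (Suc n) = factor x i n @ [x (i + int n)]"
  by (simp add: factor_def)

lemma factor_add: "factor x i (m + n) = factor x i m @ factor x (i + int m) n"
  by (induction n) (simp_all add: factor_Suc add.assoc)

lemma factor_Suc_left: "factor x i (Suc n) = x i # factor x (i + 1) n"
  using factor_add[of x i 1 n] by (simp add: factor_Suc)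

lemma set_factor: "set (factor x i n) = (\<lambda>k. x (i + int k)) ` {..<n}"
  by (auto simp: factor_def)

lemma language_eq_factors: "language X = {factor x i n | x i n. x \<in> X}"
  by (simp add: language_def factor_def)

lemma factor_in_language: "x \<in> X \<Longrightarrow> factor x i n \<in> language X"
  by (auto simp: language_eq_factors)

lemma pair_in_language: "x \<in> X \<Longrightarrow> [x i, x (i + 1)] \<in> language X"
  using factor_in_language[of x X i 2] by (simp add: factor_Suc numeral_2_eq_2)

lemma letter_has_successor:
  assumes "[a] \<in> language X"
  obtains b where "[a, b] \<in> language X"
proof -
  obtain x i n where x: "x \<in> X" "[a] = factor x i n"
    using assms by (auto simp: language_eq_factors)
  then have "n = 1"
    by (metis length_factor length_Cons list.size(3) One_nat_def)
  with x have "a = x i"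
    by (simp add: factor_Suc)
  then show ?thesis
    using that pair_in_language[OF x(1), of i] by blast
qed

text \<open>A factor of a point \<open>y\<close> determines a cylinder around \<open>y\<close>, which is open, so a dense orbit
  visits it.\<close>

lemma dense_orbit_contains_language:
  assumes dense: "X \<subseteq> full_shift closure_of (range (\<lambda>n. shift n x))"
    and w: "w \<in> language X"
  obtains m where "w = factor x m (length w)"
proof -
  obtain y i n where y: "y \<in> X" and w_eq: "w = factor y i n"
    using w by (auto simp: language_eq_factors)
  define U where "U j = (if j \<in> {i..<i + int n} then {y j} else UNIV)" for j
  have "finite {j. U j \<noteq> UNIV}"
    by (rule finite_subset[of _ "{i..<i + int n}"]) (auto simp: U_def)
  then have "openin full_shift (\<Pi>\<^sub>E j\<in>UNIV. U j)"
    unfolding full_shift_def by (intro product_topology_basis) auto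
  moreover have "y \<in> (\<Pi>\<^sub>E j\<in>UNIV. U j)"
    by (auto simp: U_def)
  moreover have "y \<in> full_shift closure_of (range (\<lambda>n. shift n x))"
    using dense y by blast
  ultimately obtain m where m: "shift m x \<in> (\<Pi>\<^sub>E j\<in>UNIV. U j)"
    unfolding in_closure_of by blast
  have "x (i + m + int k) = y (i + int k)" if "k < n" for k
  proof -
    have "shift m x (i + int k) \<in> U (i + int k)"
      using m by auto
    with that show ?thesis
      by (simp add: U_def shift_def algebra_simps)
  qed
  then have "factor x (i + m) n = factor y i n"
    by (simp add: factor_def)
  then show ?thesis
    using that[of "i + m"] w_eq by simp
qed

lemma dense_orbit_contains_letter:
  assumes "X \<subseteq> full_shift closure_of (range (\<lambda>n. shift n x))" "[a] \<in> language X"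
  obtains m where "x m = a"
proof -
  obtain m where "[a] = factor x m (length [a])"
    using dense_orbit_contains_language[OF assms] .
  then show ?thesis
    using that by (simp add: factor_Suc)
qed

lemma dense_orbit_contains_pair:
  assumes "X \<subseteq> full_shift closure_of (range (\<lambda>n. shift n x))" "[a, b] \<in> language X"
  obtains m where "x m = a" "x (m + 1) = b"
proof -
  obtain m where "[a, b] = factor x m (length [a, b])"
    using dense_orbit_contains_language[OF assms] .
  then show ?thesis
    using that by (simp add: factor_Suc)
qed


section \<open>Morphisms along a point\<close>

lemma word_morphism_determined_by_letters:
  assumes "word_morphism c" "word_morphism d" "\<And>a. c [a] = d [a]"
  shows "c = d"
proof
  fix w
  show "c w = d w"
  proof (induction w)
    case (Cons a w)
    then show ?case
      using assms unfolding word_morphism_def by (metis append_Cons append_Nil)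
  qed (use assms in \<open>simp add: word_morphism_def\<close>)
qed

text \<open>The primitive is the value of \<open>c\<close> on the factor from \<open>0\<close> to \<open>n\<close>, counted negatively when
  \<open>n < 0\<close>. For each \<open>n\<close> at least one of the two factors in the definition of \<open>p\<close> is empty.\<close>

lemma word_morphism_primitive:
  assumes c: "word_morphism c"
  obtains p :: "int \<Rightarrow> real" where "\<And>n. p (n + 1) = p n + c [x n]"
proof -
  define p where "p n = c (factor x 0 (nat n)) - c (factor x n (nat (- n)))" for n
  have "p (n + 1) = p n + c [x n]" for n
  proof (cases "0 \<le> n")
    case True
    then have "nat (n + 1) = Suc (nat n)" "nat (- n) = 0" "nat (- (n + 1)) = 0"
      by auto
    with True c show ?thesis
      by (simp add: p_def factor_Suc word_morphism_def)
  next
    case False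
    then have left: "nat (- n) = Suc (nat (- (n + 1)))" and right: "nat n = 0" "nat (n + 1) = 0"
      by auto
    have "factor x n (nat (- n)) = [x n] @ factor x (n + 1) (nat (- (n + 1)))"
      unfolding left by (simp add: factor_Suc_left)
    then have "c (factor x n (nat (- n))) = c [x n] + c (factor x (n + 1) (nat (- (n + 1))))"
      using c by (simp only: word_morphism_def)
    with right show ?thesis
      unfolding p_def by simp
  qed
  then show ?thesis
    using that by blast
qed

lemma word_morphism_factor_telescopes:
  assumes c: "word_morphism c" and p: "\<And>n. p (n + 1) = p n + c [x n]"
  shows "c (factor x i n) = p (i + int n) - p i"
proof (induction n)
  case 0
  then show ?case
    using c by (simp add: word_morphism_def)
next
  case (Suc n)
  then show ?case
    using c p[of "i + int n"] by (simp add: factor_Suc word_morphism_def add_ac)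
qed

text \<open>Cutting the factor at every occurrence of \<open>a\<close> decomposes it into return words to \<open>a\<close>.\<close>

lemma letter_coboundary_between_occurrences:
  assumes c: "c \<in> letter_coboundaries X" and x: "x \<in> X"
    and "x i = a" "x (i + int n) = a"
  shows "c (factor x i n) = 0"
  using assms(3,4)
proof (induction n arbitrary: i rule: less_induct)
  case (less n)
  have morph: "c [] = 0" "\<And>u v. c (u @ v) = c u + c v"
    using c by (auto simp: letter_coboundaries_def word_morphism_def)
  consider "n = 0" | k where "0 < k" "k < n" "x (i + int k) = a"
    | "0 < n" "\<And>k. 0 < k \<Longrightarrow> k < n \<Longrightarrow> x (i + int k) \<noteq> a"
    by blast
  then show ?case
  proof cases
    case 1
    then show ?thesis
      by (simp add: morph)
  next
    case (2 k)
    have "c (factor x i k) = 0"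
      using less.prems 2 by (intro less.IH) auto
    moreover have "c (factor x (i + int k) (n - k)) = 0"
      using less.prems 2 by (intro less.IH) (auto simp: of_nat_diff)
    ultimately show ?thesis
      using factor_add[of x i k "n - k"] 2 by (simp add: morph)
  next
    case 3
    then obtain l where l: "n = Suc l"
      using gr0_implies_Suc by blast
    have word: "factor x i n @ [a] = factor x i (Suc n)"
      using less.prems by (simp add: factor_Suc)
    have "a \<notin> set (factor x (i + 1) l)"
    proof
      assume "a \<in> set (factor x (i + 1) l)"
      then obtain k where "k < l" "x (i + int (Suc k)) = a"
        by (auto simp: set_factor add.assoc)
      with 3(2)[of "Suc k"] l show False
        by simp
    qed
    then have "count_list (factor x i n @ [a]) a = 2"
      using less.prems by (simp add: l factor_Suc_left count_list_0_iff)
    moreover have "factor x i n @ [a] \<in> language X"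
      unfolding word by (rule factor_in_language[OF x])
    moreover have "prefix [a] (factor x i n @ [a])"
      using less.prems by (simp add: l factor_Suc_left)
    ultimately have "return_word X a (factor x i n)"
      by (simp add: return_word_def suffix_def)
    then show ?thesis
      using c by (simp add: letter_coboundaries_def)
  qed
qed


section \<open>Maps constant on components\<close>

text \<open>Membership can be tested on pairs of right vertices with a common left neighbour: along a
  path, the value at the current right vertex, or at every right neighbour of the current left
  vertex, never changes.\<close>

lemma component_mapsI:
  assumes common: "\<And>a b b'. [a, b] \<in> language X \<Longrightarrow> [a, b'] \<in> language X \<Longrightarrow> \<rho> b = \<rho> b'"
  shows "\<rho> \<in> component_maps X"
proof -
  have "\<rho> a = \<rho> b" if "(Inr a, Inr b) \<in> extension_connected X" for a b
  proof -
    define inv where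
      "inv u = (case u of Inl d \<Rightarrow> \<forall>e. [d, e] \<in> language X \<longrightarrow> \<rho> e = \<rho> a | Inr e \<Rightarrow> \<rho> e = \<rho> a)"
      for u :: "'a + 'a"
    have "inv u" if "(Inr a, u) \<in> {(u, v). {u, v} \<in> extension_edges X}\<^sup>*" for u
      using that
    proof (induction rule: rtrancl_induct)
      case base
      then show ?case
        by (simp add: inv_def)
    next
      case (step u v)
      then obtain d e where "[d, e] \<in> language X" and "{u, v} = {Inl d, Inr e}"
        unfolding extension_edges_def by blast
      then consider "u = Inl d" "v = Inr e" | "u = Inr e" "v = Inl d"
        by (auto simp: doubleton_eq_iff)
      then show ?case
      proof cases
        case 1
        then show ?thesis
          using step.IH \<open>[d, e] \<in> language X\<close> by (simp add: inv_def)
      next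
        case 2
        then have "\<rho> e' = \<rho> a" if "[d, e'] \<in> language X" for e'
          using step.IH common[OF that \<open>[d, e] \<in> language X\<close>] by (simp add: inv_def)
        with 2 show ?thesis
          by (simp add: inv_def)
      qed
    qed
    then have "inv (Inr b)"
      using that by (simp add: extension_connected_def)
    then show ?thesis
      by (simp add: inv_def)
  qed
  then show ?thesis
    by (simp add: component_maps_def)
qed

lemma subspace_component_maps: "subspace (component_maps X)"
  by (auto simp: subspace_def component_maps_def scaleR_fun_def zero_fun_def plus_fun_def)

lemma constant_in_component_maps: "(\<lambda>_. t) \<in> component_maps X"
  by (simp add: component_maps_def)

lemma constant_maps_eq: "constant_maps X = range (\<lambda>t _. t)"
  by (auto simp: constant_maps_def constant_in_component_maps fun_eq_iff)

lemma subspace_constant_maps: "subspace (constant_maps X)"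
  unfolding constant_maps_eq subspace_def
  by (auto simp: scaleR_fun_def zero_fun_def plus_fun_def image_iff fun_eq_iff)

lemma subspace_letter_coboundaries: "subspace (letter_coboundaries X)"
  by (auto simp: subspace_def letter_coboundaries_def word_morphism_def scaleR_fun_def
      zero_fun_def plus_fun_def algebra_simps)

lemma linear_coboundary_of: "linear (coboundary_of X)"
proof (rule linearI)
  fix \<rho> \<sigma> :: "'a \<Rightarrow> real" and r :: real
  show "coboundary_of X (\<rho> + \<sigma>) = coboundary_of X \<rho> + coboundary_of X \<sigma>"
  proof
    fix w
    show "coboundary_of X (\<rho> + \<sigma>) w = (coboundary_of X \<rho> + coboundary_of X \<sigma>) w"
      by (induction w) (simp_all add: coboundary_of_def)
  qed
  show "coboundary_of X (r *\<^sub>R \<rho>) = r *\<^sub>R coboundary_of X \<rho>"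
  proof
    fix w
    show "coboundary_of X (r *\<^sub>R \<rho>) w = (r *\<^sub>R coboundary_of X \<rho>) w"
      by (induction w) (simp_all add: coboundary_of_def scaleR_fun_def algebra_simps)
  qed
qed


section \<open>Exactness\<close>

lemma coboundary_of_factor:
  assumes \<rho>: "\<rho> \<in> component_maps X" and x: "x \<in> X"
  shows "coboundary_of X \<rho> (factor x i n) = \<rho> (x (i + int n)) - \<rho> (x i)"
  by (rule word_morphism_factor_telescopes[where p = "\<lambda>n. \<rho> (x n)"])
    (simp_all add: word_morphism_coboundary_of coboundary_of_letter[OF \<rho> pair_in_language[OF x]])

lemma coboundary_of_in_letter_coboundaries:
  assumes \<rho>: "\<rho> \<in> component_maps X"
  shows "coboundary_of X \<rho> \<in> letter_coboundaries X"
proof -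
  have "coboundary_of X \<rho> w = 0" if ret: "return_word X a w" for a w
  proof -
    obtain x i n where x: "x \<in> X" "w @ [a] = factor x i n"
      using ret by (auto simp: return_word_def language_eq_factors)
    then have "n = Suc (length w)"
      by (metis length_append_singleton length_factor)
    with x have w: "w = factor x i (length w)" and last: "x (i + int (length w)) = a"
      by (simp_all add: factor_Suc)
    have "hd (factor x i n) = a"
      using ret x(2) by (auto simp: return_word_def prefix_def)
    then have "x i = a"
      using \<open>n = _\<close> by (simp add: factor_Suc_left)
    then show ?thesis
      using coboundary_of_factor[OF \<rho> x(1), of i "length w"] last w by simp
  qed
  then show ?thesis
    by (auto simp: letter_coboundaries_def word_morphism_coboundary_of)
qed

lemma letter_coboundary_is_coboundary_of:
  assumes x: "x \<in> X" and dense: "X \<subseteq> full_shift closure_of (range (\<lambda>n. shift n x))"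
    and letters: "\<forall>a. [a] \<in> language X"
    and c: "c \<in> letter_coboundaries X"
  obtains \<rho> where "\<rho> \<in> component_maps X" "c = coboundary_of X \<rho>"
proof -
  have morph: "word_morphism c"
    using c by (simp add: letter_coboundaries_def)
  obtain p where p: "\<And>n. p (n + 1) = p n + c [x n]"
    using word_morphism_primitive[OF morph] by blast
  have p_mono: "p m = p n" if "x m = x n" "m \<le> n" for m n
    using letter_coboundary_between_occurrences[OF c x, of m "x m" "nat (n - m)"]
      word_morphism_factor_telescopes[of c p x m "nat (n - m)", OF morph p] that
    by simp
  have p_letter: "p m = p n" if "x m = x n" for m n
    using p_mono[of m n] p_mono[of n m, OF that[symmetric]] that linear[of m n] by metis
  define \<rho> where "\<rho> a = p (SOME n. x n = a)" for a
  have \<rho>_x: "\<rho> (x n) = p n" for n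
    unfolding \<rho>_def by (rule p_letter) (rule someI[of "\<lambda>k. x k = x n" n], rule refl)
  have step: "\<rho> b = \<rho> a + c [a]" if "[a, b] \<in> language X" for a b
    using dense_orbit_contains_pair[OF dense that] \<rho>_x p by metis
  have \<rho>: "\<rho> \<in> component_maps X"
    using step by (intro component_mapsI) metis
  have "c [a] = coboundary_of X \<rho> [a]" for a
  proof -
    obtain b where "[a, b] \<in> language X"
      using letters letter_has_successor[of a X] by auto
    then show ?thesis
      using step coboundary_of_letter[OF \<rho>] by simp
  qed
  then have "c = coboundary_of X \<rho>"
    by (rule word_morphism_determined_by_letters[OF morph word_morphism_coboundary_of])
  with \<rho> show ?thesis
    using that by blast
qed

lemma coboundary_of_eq_0_iff_constant:
  assumes x: "x \<in> X" and dense: "X \<subseteq> full_shift closure_of (range (\<lambda>n. shift n x))"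
    and letters: "\<forall>a. [a] \<in> language X"
    and \<rho>: "\<rho> \<in> component_maps X"
  shows "coboundary_of X \<rho> = 0 \<longleftrightarrow> \<rho> \<in> constant_maps X"
proof
  assume zero: "coboundary_of X \<rho> = 0"
  have forward: "\<rho> (x (i + int n)) = \<rho> (x i)" for i n
    using coboundary_of_factor[OF \<rho> x, of i n] zero by simp
  have "\<rho> a = \<rho> (x 0)" for a
  proof -
    obtain m where m: "x m = a"
      using dense_orbit_contains_letter[OF dense] letters by blast
    show ?thesis
      using forward[of 0 "nat m"] forward[of m "nat (- m)"] m by (cases "0 \<le> m") simp_all
  qed
  then show "\<rho> \<in> constant_maps X"
    using \<rho> by (auto simp: constant_maps_def)
next
  assume "\<rho> \<in> constant_maps X"
  then obtain t where "\<rho> = (\<lambda>_. t)"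
    by (auto simp: constant_maps_eq)
  then show "coboundary_of X \<rho> = 0"
    by (simp add: coboundary_of_def fun_eq_iff)
qed


section \<open>A basis indexed by components\<close>

definition component_indicator :: "('a + 'a) set \<Rightarrow> 'a \<Rightarrow> real" where
  "component_indicator C b = of_bool (Inr b \<in> C)"

abbreviation right_component :: "(int \<Rightarrow> 'a) set \<Rightarrow> 'a \<Rightarrow> ('a + 'a) set" where
  "right_component X b \<equiv> extension_connected X `` {Inr b}"

lemma right_component_in_components: "right_component X b \<in> extension_components X"
  by (simp add: extension_components_def quotientI)

lemma Inr_in_component_iff:
  assumes "C \<in> extension_components X"
  shows "Inr b \<in> C \<longleftrightarrow> C = right_component X b"
proof
  assume "Inr b \<in> C"
  moreover obtain u where u: "C = extension_connected X `` {u}"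
    using assms by (auto simp: extension_components_def quotient_def)
  ultimately have "(u, Inr b) \<in> extension_connected X"
    by simp
  then show "C = right_component X b"
    unfolding u by (rule equiv_class_eq[OF equiv_extension_connected])
next
  assume "C = right_component X b"
  then show "Inr b \<in> C"
    by (simp add: extension_connected_def)
qed

text \<open>A component given by a left vertex contains the right vertices of its successors.\<close>

lemma component_is_right_component:
  assumes letters: "\<forall>a. [a] \<in> language X" and C: "C \<in> extension_components X"
  obtains b where "C = right_component X b"
proof -
  obtain u where u: "C = extension_connected X `` {u}"
    using C by (auto simp: extension_components_def quotient_def)
  show ?thesis
  proof (cases u)
    case (Inl a)
    obtain b where "[a, b] \<in> language X"
      using letters letter_has_successor[of a X] by auto
    then have "{Inl a, Inr b} \<in> extension_edges X"
      unfolding extension_edges_def by blast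
    then have "(Inl a, Inr b) \<in> extension_connected X"
      by (simp add: extension_connected_def r_into_rtrancl)
    then have "Inr b \<in> C"
      using u Inl by simp
    then show ?thesis
      using that Inr_in_component_iff[OF C] by blast
  next
    case (Inr b)
    then show ?thesis
      using that u by blast
  qed
qed

lemma component_indicator_right_component:
  assumes "C \<in> extension_components X"
  shows "component_indicator C b = of_bool (C = right_component X b)"
  using Inr_in_component_iff[OF assms] by (simp add: component_indicator_def)

lemma inj_on_component_indicator:
  assumes letters: "\<forall>a. [a] \<in> language X"
  shows "inj_on component_indicator (extension_components X)"
proof (rule inj_onI)
  fix C D
  assume C: "C \<in> extension_components X" and D: "D \<in> extension_components X"
    and eq: "component_indicator C = component_indicator D"
  obtain b where "C = right_component X b"
    using component_is_right_component[OF letters C] .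
  then show "C = D"
    using fun_cong[OF eq, of b] component_indicator_right_component[OF C, of b]
      component_indicator_right_component[OF D, of b]
    by (auto split: if_splits)
qed

lemma sum_function_apply: "(\<Sum>i\<in>I. f i) x = (\<Sum>i\<in>I. f i x)"
  by (induction I rule: infinite_finite_induct) auto

text \<open>Evaluating a combination of indicators at a letter picks out the coefficient of the one
  component containing its right copy.\<close>

lemma sum_component_indicators:
  fixes X :: "(int \<Rightarrow> 'a::finite) set"
  assumes "K \<subseteq> extension_components X"
  shows "(\<Sum>C\<in>K. t C *\<^sub>R component_indicator C) b =
    (if right_component X b \<in> K then t (right_component X b) else 0)"
proof -
  have "(\<Sum>C\<in>K. t C *\<^sub>R component_indicator C) b =
      (\<Sum>C\<in>K. if C = right_component X b then t C else 0)"
    unfolding sum_function_apply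
    using assms by (intro sum.cong) (auto simp: scaleR_fun_def component_indicator_right_component)
  then show ?thesis
    by (simp add: sum.delta)
qed

lemma independent_component_indicators:
  fixes X :: "(int \<Rightarrow> 'a::finite) set"
  assumes letters: "\<forall>a. [a] \<in> language X" and K: "K \<subseteq> extension_components X"
  shows "independent (component_indicator ` K)"
proof (rule independent_if_scalars_zero)
  fix t :: "('a \<Rightarrow> real) \<Rightarrow> real" and f
  assume sum0: "(\<Sum>f\<in>component_indicator ` K. t f *\<^sub>R f) = 0"
    and f: "f \<in> component_indicator ` K"
  obtain C where C: "C \<in> K" "f = component_indicator C"
    using f by blast
  then obtain b where b: "C = right_component X b"
    using K component_is_right_component[OF letters] by blast
  have "inj_on component_indicator K"
    using inj_on_component_indicator[OF letters] K by (rule inj_on_subset)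
  then have "(\<Sum>C\<in>K. t (component_indicator C) *\<^sub>R component_indicator C) b = 0"
    using sum0 by (simp add: sum.reindex)
  then show "t f = 0"
    using C b sum_component_indicators[OF K, of "\<lambda>C. t (component_indicator C)" b] by simp
qed simp

lemma span_component_indicators:
  fixes X :: "(int \<Rightarrow> 'a::finite) set"
  shows "span (component_indicator ` (extension_components X - {right_component X b\<^sub>0})) =
    {\<rho> \<in> component_maps X. \<rho> b\<^sub>0 = 0}" (is "span (_ ` ?K) = ?V")
proof
  have "subspace ?V"
    using subspace_component_maps[of X] by (auto simp: subspace_def scaleR_fun_def)
  moreover have "component_indicator C \<in> ?V" if C: "C \<in> ?K" for C
  proof -
    have "right_component X a = right_component X b" if "(Inr a, Inr b) \<in> extension_connected X"
      for a b
      using equiv_class_eq[OF equiv_extension_connected that] .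
    then show ?thesis
      using C by (auto simp: component_maps_def component_indicator_right_component)
  qed
  ultimately show "span (component_indicator ` ?K) \<subseteq> ?V"
    by (intro span_minimal) auto
next
  show "?V \<subseteq> span (component_indicator ` ?K)"
  proof
    fix \<rho> assume \<rho>: "\<rho> \<in> ?V"
    define t where "t C = \<rho> (SOME b. Inr b \<in> C)" for C :: "('a + 'a) set"
    have t: "t (right_component X b) = \<rho> b" for b
    proof -
      have "Inr b \<in> right_component X b"
        by (simp add: extension_connected_def)
      then have "Inr (SOME b'. Inr b' \<in> right_component X b) \<in> right_component X b"
        by (rule someI)
      then show ?thesis
        using \<rho> by (simp add: t_def component_maps_def)
    qed
    have "\<rho> = (\<Sum>C\<in>?K. t C *\<^sub>R component_indicator C)"
    proof
      fix b
      have "\<rho> b = 0" if "right_component X b = right_component X b\<^sub>0"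
        using t[of b] t[of b\<^sub>0] that \<rho> by simp
      then show "\<rho> b = (\<Sum>C\<in>?K. t C *\<^sub>R component_indicator C) b"
        by (auto simp: sum_component_indicators[of ?K X t b] t right_component_in_components)
    qed
    then show "\<rho> \<in> span (component_indicator ` ?K)"
      by (metis (no_types, lifting) imageI span_base span_scale span_sum)
  qed
qed

text \<open>Every fibre of \<open>\<eta>\<close> is a coset of the constants, so it contains exactly one map vanishing at
  the chosen letter.\<close>

lemma coboundary_of_normalized_maps:
  assumes x: "x \<in> X" and dense: "X \<subseteq> full_shift closure_of (range (\<lambda>n. shift n x))"
    and letters: "\<forall>a. [a] \<in> language X"
  shows "bij_betw (coboundary_of X) {\<rho> \<in> component_maps X. \<rho> b\<^sub>0 = 0} (letter_coboundaries X)"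
    (is "bij_betw _ ?V _")
proof -
  note lin = linear_coboundary_of[of X] and sub = subspace_component_maps[of X]
  note kernel = coboundary_of_eq_0_iff_constant[OF x dense letters]
  have "\<rho> = \<sigma>" if "\<rho> \<in> ?V" "\<sigma> \<in> ?V" "coboundary_of X \<rho> = coboundary_of X \<sigma>" for \<rho> \<sigma>
  proof -
    have "\<rho> - \<sigma> \<in> component_maps X"
      using that by (auto intro: subspace_diff[OF sub])
    moreover have "coboundary_of X (\<rho> - \<sigma>) = 0"
      using that by (simp add: linear_diff[OF lin])
    ultimately obtain s where "\<rho> - \<sigma> = (\<lambda>_. s)"
      using kernel by (auto simp: constant_maps_eq)
    then have s: "\<rho> b - \<sigma> b = s" for b
      by (metis fun_diff_def)
    have "s = 0"
      using s[of b\<^sub>0] that by simp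
    with s show ?thesis
      by auto
  qed
  then have "inj_on (coboundary_of X) ?V"
    by (intro inj_onI)
  moreover have "coboundary_of X ` ?V = letter_coboundaries X"
  proof
    show "coboundary_of X ` ?V \<subseteq> letter_coboundaries X"
      using coboundary_of_in_letter_coboundaries by blast
    show "letter_coboundaries X \<subseteq> coboundary_of X ` ?V"
    proof
      fix c assume "c \<in> letter_coboundaries X"
      then obtain \<rho> where \<rho>: "\<rho> \<in> component_maps X" "c = coboundary_of X \<rho>"
        using letter_coboundary_is_coboundary_of[OF x dense letters] by blast
      define \<kappa> where "\<kappa> = (\<lambda>_::'a. \<rho> b\<^sub>0)"
      have \<kappa>: "\<kappa> \<in> component_maps X" "\<kappa> \<in> constant_maps X"
        by (auto simp: \<kappa>_def constant_in_component_maps constant_maps_eq)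
      then have "coboundary_of X (\<rho> - \<kappa>) = c"
        using \<rho> kernel by (simp add: linear_diff[OF lin])
      moreover have "\<rho> - \<kappa> \<in> ?V"
        using \<rho> \<kappa> subspace_diff[OF sub] by (simp add: \<kappa>_def)
      ultimately show "c \<in> coboundary_of X ` ?V"
        by blast
    qed
  qed
  ultimately show ?thesis
    by (simp add: bij_betw_def)
qed

theorem theorem3p14:
  fixes X :: "(int \<Rightarrow> 'a::finite) set"
  assumes "transitive_subshift X"
    and "\<forall>a. [a] \<in> language X"
  shows "short_exact_sequence
           (constant_maps X) (\<lambda>\<rho>. \<rho>) (component_maps X) (coboundary_of X) (letter_coboundaries X) \<and>
         (\<exists>B. finite B \<and> span B = letter_coboundaries X) \<and>
         int (dim (letter_coboundaries X)) = int (card (extension_components X)) - 1"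
proof -
  note letters = assms(2)
  obtain x where x: "x \<in> X" and dense: "X \<subseteq> full_shift closure_of (range (\<lambda>n. shift n x))"
    using assms(1) by (auto simp: transitive_subshift_def)
  note lin = linear_coboundary_of[of X]
  have into: "coboundary_of X ` component_maps X \<subseteq> letter_coboundaries X"
    using coboundary_of_in_letter_coboundaries by blast
  have onto: "letter_coboundaries X \<subseteq> coboundary_of X ` component_maps X"
    using letter_coboundary_is_coboundary_of[OF x dense letters] by blast
  have "constant_maps X \<subseteq> component_maps X"
    by (auto simp: constant_maps_def)
  then have "constant_maps X = {\<rho> \<in> component_maps X. coboundary_of X \<rho> = 0}"
    using coboundary_of_eq_0_iff_constant[OF x dense letters] by blast
  then have exact: "short_exact_sequence
      (constant_maps X) (\<lambda>\<rho>. \<rho>) (component_maps X) (coboundary_of X) (letter_coboundaries X)"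
    using into onto \<open>constant_maps X \<subseteq> component_maps X\<close> subspace_constant_maps[of X]
    by (auto simp: short_exact_sequence_def linear_between_def
        subspace_component_maps subspace_letter_coboundaries linear_add[OF lin]
        linear_scale[OF lin])

  fix b\<^sub>0 :: 'a
  define K where "K = extension_components X - {right_component X b\<^sub>0}"
  define S where "S = component_indicator ` K"
  define B where "B = coboundary_of X ` S"
  have spanS: "span S = {\<rho> \<in> component_maps X. \<rho> b\<^sub>0 = 0}"
    unfolding S_def K_def by (rule span_component_indicators)
  have inj: "inj_on (coboundary_of X) (span S)"
    and image: "coboundary_of X ` span S = letter_coboundaries X"
    using coboundary_of_normalized_maps[OF x dense letters, of b\<^sub>0]
    unfolding spanS bij_betw_def by auto
  have spanB: "span B = letter_coboundaries X"
    unfolding B_def linear_span_image[OF lin] by (rule image)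
  have "independent S"
    unfolding S_def by (rule independent_component_indicators[OF letters]) (simp add: K_def)
  then have "independent B"
    unfolding B_def using inj by (rule linear_independent_injective_image[OF lin])
  then have "dim (letter_coboundaries X) = card B"
    by (intro dim_eq_card) (simp_all add: spanB[symmetric] span_span)
  also have "card B = card S"
    unfolding B_def using inj_on_subset[OF inj span_superset] by (rule card_image)
  also have "card S = card K"
    unfolding S_def K_def
    using inj_on_subset[OF inj_on_component_indicator[OF letters] Diff_subset]
    by (rule card_image)
  also have "int (card K) = int (card (extension_components X)) - 1"
  proof -
    have "card (extension_components X) = Suc (card K)"
      unfolding K_def using right_component_in_components by (intro card.remove) auto
    then show ?thesis
      by simp
  qed
  finally have dim: "int (dim (letter_coboundaries X)) = int (card (extension_components X)) - 1" .
  have "finite B"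
    by (simp add: B_def S_def)
  with exact spanB dim show ?thesis
    by blast
qed

end
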